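(* Assume that $\lambda_1(t)<\lambda_2(t)$ for every $t\in I$. For $t\in I$ write $\lambda=\lambda_1(t)$, $\phi_t=u_1(t)$ and $$\dot A=\dot A_t(\phi_t,\phi_t),\quad \ddot A=\ddot A_t(\phi_t,\phi_t),\quad \dot B=\dot B_t(\phi_t,\phi_t),\quad \ddot B=\ddot B_t(\phi_t,\phi_t).$$ If $$2\dot A^2+\lambda^2\ddot B\ \ge\ \lambda(\ddot A+2\dot A\dot B),$$ then $$\frac{d^2}{dt^2}\frac1{\lambda_1(t)}\ge0$$ (at this $t$).
   Context: Let $(X,|\cdot|)$ and $(V,\|\cdot\|)$ be real Hilbert spaces with compact embedding $V\hookrightarrow X$; $V$ is infinite dimensional and dense in $X$. Let $I=(-\varepsilon_0,\varepsilon_0)$, $\varepsilon_0>0$. For $t\in I$ let $A_t:V\times V\to\mathbb{R}$ and $B_t:X\times X\to\mathbb{R}$ be symmetric bilinear forms for which there are constants $C,\delta>0$ independent of $t$ with $$|A_t(u,v)|\le C\|u\|\|v\|,\quad A_t(u,u)\ge\delta\|u\|^2\quad (u,v\in V),$$ $$|B_t(u,v)|\le C|u||v|,\quad B_t(u,u)\ge\delta|u|^2\quad (u,v\in X).$$ Consider the eigenvalue problem: $u\in V$, $B_t(u,u)=1$, $A_t(u,v)=\lambda B_t(u,v)$ for all $v\in V$. Its eigenvalues, counted with multiplicity, are $0<\lambda_1(t)\le\lambda_2(t)\le\cdots\to+\infty$, with eigenfunctions $u_1(t),u_2(t),\dots$ forming a complete orthonormal system in $X$ with respect to the inner product $B_t$.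 Standing differentiability assumptions: for every $t\in I$ there are bilinear forms $\dot A_t,\ddot A_t:V\times V\to\mathbb{R}$ and $\dot B_t,\ddot B_t:X\times X\to\mathbb{R}$ such that, with $C$ independent of $t$, $$|\dot A_t(u,v)|,\ |\ddot A_t(u,v)|\le C\|u\|\|v\|\ (u,v\in V),\qquad |\dot B_t(u,v)|,\ |\ddot B_t(u,v)|\le C|u||v|\ (u,v\in X),$$ and, for every $t\in I$, $$\lim_{h\to0}\tfrac1h\sup_{\|u\|,\|v\|\le1}|(A_{t+h}-A_t-h\dot A_t)(u,v)|=0,\qquad \lim_{h\to0}\tfrac1h\sup_{|u|,|v|\le1}|(B_{t+h}-B_t-h\dot B_t)(u,v)|=0,$$ $$\lim_{h\to0}\tfrac1{h^2}\sup_{\|u\|,\|v\|\le1}|(A_{t+h}-A_t-h\dot A_t-\tfrac{h^2}{2}\ddot A_t)(u,v)|=0,\qquad \lim_{h\to0}\tfrac1{h^2}\sup_{|u|,|v|\le1}|(B_{t+h}-B_t-h\dot B_t-\tfrac{h^2}{2}\ddot B_t)(u,v)|=0,$$ $$\lim_{h\to0}\sup_{\|u\|,\|v\|\le1}|(\dot A_{t+h}-\dot A_t)(u,v)|=\lim_{h\to0}\sup_{\|u\|,\|v\|\le1}|(\ddot A_{t+h}-\ddot A_t)(u,v)|=0,$$ $$\lim_{h\to0}\sup_{|u|,|v|\le1}|(\dot B_{t+h}-\dot B_t)(u,v)|=\lim_{h\to0}\sup_{|u|,|v|\le1}|(\ddot B_{t+h}-\ddot B_t)(u,v)|=0.$$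 Under these assumptions and $\lambda_1(t)<\lambda_2(t)$ for all $t\in I$, the function $\lambda_1$ is known to be of class $C^2$ on $I$. *)

theory Defs
  imports "HOL-Analysis.Analysis"
begin

(* V is not a subset of X here: J is the inclusion map of V into X. *)
definition compact_dense_embedding ::
    "('v::real_normed_vector \<Rightarrow> 'x::real_normed_vector) \<Rightarrow> bool" where
  "compact_dense_embedding J \<longleftrightarrow>
     bounded_linear J \<and> inj J \<and>
     (\<forall>S. bounded S \<longrightarrow> compact (closure (J ` S))) \<and>
     closure (range J) = UNIV"

definition infinite_dimensional :: "'v::real_vector itself \<Rightarrow> bool" where
  "infinite_dimensional _ \<longleftrightarrow> (\<forall>S::'v set. finite S \<longrightarrow> span S \<noteq> UNIV)"

definition uniformly_elliptic ::
    "real set \<Rightarrow> (real \<Rightarrow> 'a::real_normed_vector \<Rightarrow> 'a \<Rightarrow> real) \<Rightarrow> bool" where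
  "uniformly_elliptic I F \<longleftrightarrow>
     (\<forall>t\<in>I. bilinear (F t) \<and> (\<forall>u v. F t u v = F t v u)) \<and>
     (\<exists>C>0. \<exists>\<delta>>0. \<forall>t\<in>I.
        (\<forall>u v. \<bar>F t u v\<bar> \<le> C * norm u * norm v) \<and>
        (\<forall>u. F t u u \<ge> \<delta> * (norm u)\<^sup>2))"

(* Only applied to bounded forms, for which the supremum is finite. *)
definition form_norm :: "('a::real_normed_vector \<Rightarrow> 'a \<Rightarrow> real) \<Rightarrow> real" where
  "form_norm F = (SUP (u, v)\<in>cball 0 1 \<times> cball 0 1. \<bar>F u v\<bar>)"

definition twice_differentiable_forms ::
    "real set \<Rightarrow> (real \<Rightarrow> 'a::real_normed_vector \<Rightarrow> 'a \<Rightarrow> real) \<Rightarrow>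
     (real \<Rightarrow> 'a \<Rightarrow> 'a \<Rightarrow> real) \<Rightarrow> (real \<Rightarrow> 'a \<Rightarrow> 'a \<Rightarrow> real) \<Rightarrow> bool" where
  "twice_differentiable_forms I F F' F'' \<longleftrightarrow>
     (\<forall>t\<in>I. bilinear (F' t) \<and> bilinear (F'' t)) \<and>
     (\<exists>C>0. \<forall>t\<in>I. \<forall>u v.
        \<bar>F' t u v\<bar> \<le> C * norm u * norm v \<and> \<bar>F'' t u v\<bar> \<le> C * norm u * norm v) \<and>
     (\<forall>t\<in>I.
        ((\<lambda>h. form_norm (\<lambda>u v. F (t + h) u v - F t u v - h * F' t u v) / h)
           \<longlongrightarrow> 0) (at 0) \<and>
        ((\<lambda>h. form_norm (\<lambda>u v. F (t + h) u v - F t u v - h * F' t u v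
                                - h\<^sup>2 / 2 * F'' t u v) / h\<^sup>2)
           \<longlongrightarrow> 0) (at 0) \<and>
        ((\<lambda>h. form_norm (\<lambda>u v. F' (t + h) u v - F' t u v)) \<longlongrightarrow> 0) (at 0) \<and>
        ((\<lambda>h. form_norm (\<lambda>u v. F'' (t + h) u v - F'' t u v)) \<longlongrightarrow> 0) (at 0))"

definition eigenpair ::
    "('v \<Rightarrow> 'x) \<Rightarrow> ('v \<Rightarrow> 'v \<Rightarrow> real) \<Rightarrow> ('x \<Rightarrow> 'x \<Rightarrow> real) \<Rightarrow> real \<Rightarrow> 'v \<Rightarrow> bool" where
  "eigenpair J A B \<mu> w \<longleftrightarrow>
     B (J w) (J w) = 1 \<and> (\<forall>v. A w v = \<mu> * B (J w) (J v))"

definition complete_orthonormal ::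
    "('x::real_normed_vector \<Rightarrow> 'x \<Rightarrow> real) \<Rightarrow> (nat \<Rightarrow> 'x) \<Rightarrow> bool" where
  "complete_orthonormal B e \<longleftrightarrow>
     (\<forall>i j. B (e i) (e j) = (if i = j then 1 else 0)) \<and>
     closure (span (range e)) = UNIV"

(* Indices start at 0, so \<mu> k is the (k+1)-st eigenvalue. Since the eigenfunctions form a
   complete orthonormal system, \<mu> lists every eigenvalue, repeated according to multiplicity. *)
definition eigensystem ::
    "('v \<Rightarrow> 'x::real_normed_vector) \<Rightarrow> ('v \<Rightarrow> 'v \<Rightarrow> real) \<Rightarrow> ('x \<Rightarrow> 'x \<Rightarrow> real) \<Rightarrow>
     (nat \<Rightarrow> real) \<Rightarrow> (nat \<Rightarrow> 'v) \<Rightarrow> bool" where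
  "eigensystem J A B \<mu> w \<longleftrightarrow>
     (\<forall>k. eigenpair J A B (\<mu> k) (w k)) \<and>
     0 < \<mu> 0 \<and> mono \<mu> \<and> filterlim \<mu> at_top sequentially \<and>
     complete_orthonormal B (\<lambda>k. J (w k))"

end

theory Submission
  imports Defs
begin

text \<open>Transport \<open>B\<close> to \<open>V\<close> by the embedding, giving a
  form \<open>b\<close>, and write \<open>a\<close> for \<open>A\<close>. Then \<open>f = 1 / \<lambda>\<^sub>1\<close> is the largest eigenvalue of \<open>b\<close> relative to \<open>a\<close>:
  the form \<open>M = f a - b\<close> is positive semidefinite and annihilates the eigenfunction \<open>\<phi>\<close>. Differentiating
  \<open>M \<phi> = 0\<close> once gives \<open>M' \<phi> + M w = 0\<close> for the derivative \<open>w\<close> of \<open>\<phi>\<close>, whence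
  \<open>f' a(\<phi>,\<phi>) = b'(\<phi>,\<phi>) - f a'(\<phi>,\<phi>)\<close> and \<open>M'(\<phi>,w) = - M(w,w)\<close>. Differentiating once more gives
  \<open>f'' a(\<phi>,\<phi>) = b''(\<phi>,\<phi>) - f a''(\<phi>,\<phi>) - 2 f' a'(\<phi>,\<phi>) + 2 M(w,w)\<close>.
  The last term is nonnegative, and after inserting \<open>a(\<phi>,\<phi>) = \<lambda>\<^sub>1\<close> and the formula for \<open>f'\<close> the other
  terms on the right equal \<open>1 / \<lambda>\<^sub>1\<^sup>2\<close> times the difference of the two sides of the hypothesis.

  What needs work is that these derivatives exist. Three ingredients carry this.

  The hypotheses on the forms give second-order expansions at every parameter with continuous second
  coefficient, but do not say directly that the first derivative of the forms is differentiable; a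
  convexity argument shows that it is (\<open>has_second_derivative_if_expansion\<close>).

  Expansion in eigenfunctions bounds the Rayleigh quotient on the complement of \<open>\<phi>\<close> by the next
  eigenvalue (\<open>eigenvalue_le_rayleigh_quotient\<close>). As \<open>\<lambda>\<^sub>1\<close> is simple, \<open>M\<close> is coercive there.

  Coercivity makes suitably normalised eigenfunctions converge, and it makes \<open>M\<close> bounded below on
  their difference quotients, so that these converge as well (\<open>\<psi>_deriv\<close>). The formula for \<open>f'\<close> can
  then be differentiated (\<open>eigenvalue_second_deriv\<close>).\<close>

section \<open>Second derivatives from second-order expansions\<close>

text \<open>In this expansion \<open>q x\<close> is only a Peano derivative at the single point \<open>x\<close>: nothing is assumed
  about difference quotients of \<open>p\<close>. The lemmas below recover an honest derivative of \<open>p\<close> from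
  expansions holding at all points.\<close>

definition second_order_expansion ::
    "(real \<Rightarrow> real) \<Rightarrow> (real \<Rightarrow> real) \<Rightarrow> (real \<Rightarrow> real) \<Rightarrow> real \<Rightarrow> bool" where
  "second_order_expansion g p q x \<longleftrightarrow>
     ((\<lambda>h. (g (x + h) - g x - h * p x - h\<^sup>2 / 2 * q x) / h\<^sup>2) \<longlongrightarrow> 0) (at 0)"

text \<open>A positive second coefficient at every point forces \<open>g\<close> to lie below its chord: an interior
  maximum of \<open>g\<close> minus the chord would be a critical point at which the expansion makes the function
  grow. Lying below the chord bounds the slope at the left end by the chord slope \<open>m\<close>, and the slope
  at the right end from below by \<open>m\<close>.\<close>

lemma positive_second_coefficient_imp_deriv_le:
  fixes g p q :: "real \<Rightarrow> real"
  assumes ab: "a < b"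
    and D: "\<And>x. x \<in> {a..b} \<Longrightarrow> (g has_real_derivative p x) (at x)"
    and E: "\<And>x. x \<in> {a..b} \<Longrightarrow> second_order_expansion g p q x"
    and pos: "\<And>x. x \<in> {a..b} \<Longrightarrow> q x > 0"
  shows "p a \<le> p b"
proof -
  define m where "m = (g b - g a) / (b - a)"
  define k where "k x = g x - m * (x - a)" for x
  have kab: "k b = k a" using ab by (simp add: k_def m_def)
  have Dk: "(k has_real_derivative p x - m) (at x)" if "x \<in> {a..b}" for x
    unfolding k_def by (auto intro!: derivative_eq_intros D that)
  have "continuous_on {a..b} k"
    using Dk by (meson DERIV_isCont continuous_at_imp_continuous_on)
  then obtain x0 where x0: "x0 \<in> {a..b}" and mx: "\<And>y. y \<in> {a..b} \<Longrightarrow> k y \<le> k x0"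
    using continuous_attains_sup[of "{a..b}" k] ab by auto
  have below: "k y \<le> k a" if "y \<in> {a..b}" for y
  proof (cases "x0 \<in> {a<..<b}")
    case False
    then have "x0 = a \<or> x0 = b" using x0 by auto
    then show ?thesis using mx[OF that] kab by auto
  next
    case True
    define d where "d = min (x0 - a) (b - x0)"
    have d: "d > 0" using True by (auto simp: d_def)
    have near: "y \<in> {a..b}" if "\<bar>x0 - y\<bar> < d" for y
      using that by (auto simp: d_def)
    have "p x0 - m = 0"
      by (rule DERIV_local_max[OF Dk[OF x0] d]) (use near mx in auto)
    then have pm: "p x0 = m" by simp
    have "\<forall>\<^sub>F h in at 0. dist ((g (x0 + h) - g x0 - h * p x0 - h\<^sup>2 / 2 * q x0) / h\<^sup>2) 0 < q x0 / 2"
      using E[OF x0] pos[OF x0] unfolding second_order_expansion_def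
      by (intro tendstoD) auto
    moreover have "\<forall>\<^sub>F h in at 0. \<bar>h\<bar> < d"
      using d by (auto simp: eventually_at intro!: exI[of _ d])
    moreover have "\<forall>\<^sub>F h in at (0::real). h \<noteq> 0"
      by (simp add: eventually_at_filter)
    ultimately have "\<forall>\<^sub>F h in at (0::real). False"
    proof eventually_elim
      case (elim h)
      then have h2: "h\<^sup>2 > 0" by simp
      have "- (q x0 / 2) < (g (x0 + h) - g x0 - h * p x0 - h\<^sup>2 / 2 * q x0) / h\<^sup>2"
        using elim(1) unfolding dist_real_def diff_0_right by (rule abs_less_iff[THEN iffD1, THEN conjunct2, THEN minus_less_iff[THEN iffD1]])
      then have "- (q x0 / 2) * h\<^sup>2 < g (x0 + h) - g x0 - h * p x0 - h\<^sup>2 / 2 * q x0"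
        using h2 by (simp only: pos_less_divide_eq)
      then have "g (x0 + h) - g x0 - h * p x0 > 0" by (simp add: field_simps)
      then have "k (x0 + h) > k x0" by (simp add: k_def pm algebra_simps)
      moreover have "x0 + h \<in> {a..b}" using near[of "x0 + h"] elim by simp
      ultimately show False using mx by force
    qed
    then show ?thesis by simp
  qed
  have "p a - m \<le> 0"
  proof (rule ccontr)
    assume "\<not> p a - m \<le> 0"
    then obtain d where d: "d > 0" "\<And>h. h > 0 \<Longrightarrow> h < d \<Longrightarrow> k a < k (a + h)"
      using DERIV_pos_inc_right[OF Dk[of a]] ab by auto
    define h where "h = min (d / 2) (b - a)"
    have "h > 0" "h < d" "a + h \<in> {a..b}" using d ab by (auto simp: h_def)
    then show False using d(2)[of h] below[of "a + h"] by simp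
  qed
  moreover have "p b - m \<ge> 0"
  proof (rule ccontr)
    assume "\<not> p b - m \<ge> 0"
    then obtain d where d: "d > 0" "\<And>h. h > 0 \<Longrightarrow> h < d \<Longrightarrow> k b < k (b - h)"
      using DERIV_neg_dec_left[OF Dk[of b]] ab by auto
    define h where "h = min (d / 2) (b - a)"
    have "h > 0" "h < d" "b - h \<in> {a..b}" using d ab by (auto simp: h_def)
    then show False using d(2)[of h] below[of "b - h"] kab by simp
  qed
  ultimately show ?thesis by simp
qed

text \<open>Subtracting the parabola \<open>c * x\<^sup>2 / 2\<close> reduces a general lower bound to a positive coefficient.\<close>

lemma second_coefficient_gt_imp_deriv_diff_ge:
  fixes g p q :: "real \<Rightarrow> real"
  assumes "a \<le> b"
    and D: "\<And>x. x \<in> {a..b} \<Longrightarrow> (g has_real_derivative p x) (at x)"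
    and E: "\<And>x. x \<in> {a..b} \<Longrightarrow> second_order_expansion g p q x"
    and lower: "\<And>x. x \<in> {a..b} \<Longrightarrow> q x > c"
  shows "c * (b - a) \<le> p b - p a"
proof (cases "a = b")
  case False
  have "p a - c * a \<le> p b - c * b"
  proof (rule positive_second_coefficient_imp_deriv_le[where g = "\<lambda>x. g x - c * x\<^sup>2 / 2"
        and p = "\<lambda>x. p x - c * x" and q = "\<lambda>x. q x - c"])
    show "a < b" using False assms(1) by simp
    fix x assume x: "x \<in> {a..b}"
    show "((\<lambda>x. g x - c * x\<^sup>2 / 2) has_real_derivative p x - c * x) (at x)"
      by (auto intro!: derivative_eq_intros D x)
    have "(g (x + h) - c * (x + h)\<^sup>2 / 2 - (g x - c * x\<^sup>2 / 2) - h * (p x - c * x) - h\<^sup>2 / 2 * (q x - c))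
        = (g (x + h) - g x - h * p x - h\<^sup>2 / 2 * q x)" for h
      by (simp add: algebra_simps power2_eq_square add_divide_distrib diff_divide_distrib)
    then show "second_order_expansion (\<lambda>x. g x - c * x\<^sup>2 / 2) (\<lambda>x. p x - c * x) (\<lambda>x. q x - c) x"
      using E[OF x] unfolding second_order_expansion_def by (simp only:)
    show "0 < q x - c" using lower[OF x] by simp
  qed
  then show ?thesis by (simp add: algebra_simps)
qed simp

lemma second_order_expansion_minus:
  assumes "second_order_expansion g p q x"
  shows "second_order_expansion (\<lambda>x. - g x) (\<lambda>x. - p x) (\<lambda>x. - q x) x"
proof -
  have "(- g (x + h) - - g x - h * - p x - h\<^sup>2 / 2 * - q x) / h\<^sup>2
      = - ((g (x + h) - g x - h * p x - h\<^sup>2 / 2 * q x) / h\<^sup>2)" for h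
    by (subst minus_divide_left) simp
  then show ?thesis
    using tendsto_minus[OF assms[unfolded second_order_expansion_def]]
    unfolding second_order_expansion_def by simp
qed

text \<open>A substitute for the mean value theorem applied to \<open>p\<close>, whose differentiability is not yet known.\<close>

lemma deriv_increment_near_second_coefficient:
  fixes g p q :: "real \<Rightarrow> real"
  assumes D: "\<And>x. x \<in> closed_segment a b \<Longrightarrow> (g has_real_derivative p x) (at x)"
    and E: "\<And>x. x \<in> closed_segment a b \<Longrightarrow> second_order_expansion g p q x"
    and close: "\<And>x. x \<in> closed_segment a b \<Longrightarrow> \<bar>q x - c\<bar> < e"
  shows "\<bar>p b - p a - c * (b - a)\<bar> \<le> e * \<bar>b - a\<bar>"
proof -
  have *: "\<bar>p v - p u - c * (v - u)\<bar> \<le> e * (v - u)"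
    if uv: "u \<le> v" "{u..v} = closed_segment a b" for u v
  proof -
    have "(c - e) * (v - u) \<le> p v - p u"
      by (rule second_coefficient_gt_imp_deriv_diff_ge[where g = g and q = q])
        (use uv D E close in \<open>auto simp: abs_less_iff algebra_simps\<close>)
    moreover have "(- c - e) * (v - u) \<le> (- p v) - (- p u)"
    proof (rule second_coefficient_gt_imp_deriv_diff_ge[where g = "\<lambda>x. - g x" and q = "\<lambda>x. - q x"])
      fix x assume x: "x \<in> {u..v}"
      then have x': "x \<in> closed_segment a b" using uv by simp
      show "((\<lambda>x. - g x) has_real_derivative - p x) (at x)"
        by (rule DERIV_minus[OF D[OF x']])
      show "second_order_expansion (\<lambda>x. - g x) (\<lambda>x. - p x) (\<lambda>x. - q x) x"
        by (rule second_order_expansion_minus[OF E[OF x']])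
      show "- c - e < - q x" using close[OF x'] by linarith
    qed (use uv in simp)
    ultimately show ?thesis by (simp add: algebra_simps abs_le_iff)
  qed
  show ?thesis
  proof (cases "a \<le> b")
    case True
    then show ?thesis using *[of a b] by (simp add: closed_segment_eq_real_ivl)
  next
    case False
    then have "\<bar>p a - p b - c * (a - b)\<bar> \<le> e * (a - b)"
      using *[of b a] by (simp add: closed_segment_eq_real_ivl)
    moreover have "\<bar>p b - p a - c * (b - a)\<bar> = \<bar>p a - p b - c * (a - b)\<bar>"
      by (simp add: algebra_simps)
    ultimately show ?thesis using False by simp
  qed
qed

section \<open>Bounded forms as elements of a Banach space\<close>

lemma has_vector_derivative_iff_quotient:
  fixes f :: "real \<Rightarrow> 'a::real_normed_vector"
  shows "(f has_vector_derivative D) (at x) \<longleftrightarrow>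
    ((\<lambda>s. inverse (s - x) *\<^sub>R (f s - f x)) \<longlongrightarrow> D) (at x)"
proof -
  have "(f has_vector_derivative D) (at x) \<longleftrightarrow>
    ((\<lambda>s. norm (f s - f x - (s - x) *\<^sub>R D) / norm (s - x)) \<longlongrightarrow> 0) (at x)"
    unfolding has_vector_derivative_def has_derivative_iff_norm
    by (simp add: bounded_linear_scaleR_left)
  also have "\<dots> \<longleftrightarrow> ((\<lambda>s. norm (inverse (s - x) *\<^sub>R (f s - f x) - D)) \<longlongrightarrow> 0) (at x)"
  proof (rule tendsto_cong)
    show "\<forall>\<^sub>F s in at x. norm (f s - f x - (s - x) *\<^sub>R D) / norm (s - x)
        = norm (inverse (s - x) *\<^sub>R (f s - f x) - D)"
      unfolding eventually_at_filter
    proof (rule always_eventually, intro allI impI)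
      fix s :: real assume "s \<noteq> x"
      then have "inverse (s - x) *\<^sub>R (f s - f x) - D = inverse (s - x) *\<^sub>R (f s - f x - (s - x) *\<^sub>R D)"
        by (simp add: scaleR_diff_right)
      then show "norm (f s - f x - (s - x) *\<^sub>R D) / norm (s - x)
        = norm (inverse (s - x) *\<^sub>R (f s - f x) - D)"
        by (simp add: divide_inverse mult.commute)
    qed
  qed
  also have "\<dots> \<longleftrightarrow> ((\<lambda>s. inverse (s - x) *\<^sub>R (f s - f x)) \<longlongrightarrow> D) (at x)"
    by (simp add: tendsto_norm_zero_iff Lim_null[symmetric])
  finally show ?thesis .
qed

text \<open>Bounded bilinear forms become elements of a space of bounded linear maps, so that limits and
  product rules for them come from the theory of vector-valued functions.\<close>

definition form_op ::
    "('a::real_normed_vector \<Rightarrow> 'a \<Rightarrow> real) \<Rightarrow> 'a \<Rightarrow>\<^sub>L 'a \<Rightarrow>\<^sub>L real" where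
  "form_op F = Blinfun (\<lambda>u. Blinfun (F u))"

lemma form_op_apply [simp]:
  assumes "bounded_bilinear F"
  shows "blinfun_apply (blinfun_apply (form_op F) u) v = F u v"
proof -
  interpret F: bounded_bilinear F by fact
  have "bounded_linear (\<lambda>u. Blinfun (F u))"
  proof -
    obtain K where K: "\<And>u v. norm (F u v) \<le> norm u * norm v * K" "K > 0"
      using F.pos_bounded by blast
    show ?thesis
    proof (rule bounded_linear_intro[where K = K])
      show "norm (Blinfun (F u)) \<le> norm u * K" for u
      proof (rule norm_blinfun_bound)
        show "norm (Blinfun (F u) v) \<le> norm u * K * norm v" for v
          using K(1)[of u v] by (simp add: bounded_linear_Blinfun_apply F.bounded_linear_right ac_simps)
      qed (use K in simp)
    qed (auto intro!: blinfun_eqI simp: bounded_linear_Blinfun_apply F.bounded_linear_right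
          F.add_left F.scaleR_left blinfun.bilinear_simps)
  qed
  then show ?thesis
    by (simp add: form_op_def bounded_linear_Blinfun_apply F.bounded_linear_right)
qed

lemma norm_bilinear_blinfun_le:
  fixes T :: "'a::real_normed_vector \<Rightarrow>\<^sub>L 'b::real_normed_vector \<Rightarrow>\<^sub>L real"
  assumes "C \<ge> 0" "\<And>u v. \<bar>T u v\<bar> \<le> C * norm u * norm v"
  shows "norm T \<le> C"
  using assms by (intro norm_blinfun_bound) auto

lemma abs_bilinear_blinfun_le:
  fixes T :: "'a::real_normed_vector \<Rightarrow>\<^sub>L 'b::real_normed_vector \<Rightarrow>\<^sub>L real"
  shows "\<bar>T u v\<bar> \<le> norm T * norm u * norm v"
proof -
  have "\<bar>T u v\<bar> \<le> norm (T u) * norm v" using norm_blinfun[of "T u" v] by simp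
  also have "\<dots> \<le> norm T * norm u * norm v"
    by (intro mult_right_mono norm_blinfun) auto
  finally show ?thesis .
qed

lemma form_norm_bound:
  assumes "bounded_bilinear F"
  shows "\<bar>F u v\<bar> \<le> form_norm F * norm u * norm v" and "form_norm F \<ge> 0"
proof -
  interpret F: bounded_bilinear F by fact
  obtain K where K: "\<And>u v. norm (F u v) \<le> norm u * norm v * K" "K > 0"
    using F.pos_bounded by blast
  have bdd: "bdd_above ((\<lambda>(u, v). \<bar>F u v\<bar>) ` (cball 0 1 \<times> cball 0 1))"
  proof (rule bdd_aboveI[where M = K], clarsimp)
    fix u v :: 'a assume "norm u \<le> 1" "norm v \<le> 1"
    then have "norm u * norm v \<le> 1 * 1" by (intro mult_mono) auto
    then have "norm u * norm v * K \<le> 1 * K" using K(2) by (intro mult_right_mono) auto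
    then show "\<bar>F u v\<bar> \<le> K" using K(1)[of u v] by simp
  qed
  have le: "\<bar>F u v\<bar> \<le> form_norm F" if "norm u \<le> 1" "norm v \<le> 1" for u v
    unfolding form_norm_def using cSUP_upper[OF _ bdd, of "(u, v)"] that by simp
  show "form_norm F \<ge> 0" using le[of 0 0] by simp
  show "\<bar>F u v\<bar> \<le> form_norm F * norm u * norm v"
  proof (cases "u = 0 \<or> v = 0")
    case True
    then show ?thesis by (auto simp: F.zero_left F.zero_right)
  next
    case False
    have "\<bar>F (u /\<^sub>R norm u) (v /\<^sub>R norm v)\<bar> \<le> form_norm F"
      using False by (intro le) auto
    then show ?thesis using False
      by (simp add: F.scaleR_left F.scaleR_right abs_mult field_simps)
  qed
qed

lemma bounded_bilinear_if_bilinear: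
  fixes F :: "'a::real_normed_vector \<Rightarrow> 'a \<Rightarrow> real"
  assumes "bilinear F" "\<And>u v. \<bar>F u v\<bar> \<le> C * norm u * norm v"
  shows "bounded_bilinear F"
proof
  show "\<exists>K. \<forall>a b. norm (F a b) \<le> norm a * norm b * K"
    using assms(2) by (intro exI[of _ C]) (simp add: algebra_simps)
qed (use assms(1) in \<open>simp_all add: bilinear_ladd bilinear_radd bilinear_lmul bilinear_rmul\<close>)


lemma norm_le_form_norm:
  fixes T :: "'a::real_normed_vector \<Rightarrow>\<^sub>L 'a \<Rightarrow>\<^sub>L real"
  assumes "\<And>u v. T u v = G u v"
  shows "norm T \<le> form_norm G"
proof -
  have "bounded_bilinear G"
  proof (rule bounded_bilinear_if_bilinear)
    show "bilinear G"
      unfolding bilinear_def assms[symmetric] by (auto intro!: linearI simp: blinfun.bilinear_simps)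
    show "\<bar>G u v\<bar> \<le> norm T * norm u * norm v" for u v
      using abs_bilinear_blinfun_le[of T u v] assms by simp
  qed
  then show ?thesis
    using form_norm_bound[of G] assms by (intro norm_bilinear_blinfun_le) auto
qed

text \<open>A second-order expansion at each point does not by itself say that \<open>T'\<close> is differentiable.
  Continuity of \<open>T''\<close> in norm closes the gap: for fixed arguments \<open>u\<close> and \<open>v\<close> the increment estimate
  above controls \<open>T'\<close>, and its error is uniform over \<open>u\<close> and \<open>v\<close> in the unit ball because the
  oscillation of \<open>T''\<close> is.\<close>

lemma has_second_derivative_if_expansion:
  fixes T T' T'' :: "real \<Rightarrow> 'a::real_normed_vector \<Rightarrow>\<^sub>L 'a \<Rightarrow>\<^sub>L real"
  assumes "open I" "t \<in> I"
    and D: "\<And>s. s \<in> I \<Longrightarrow> (T has_vector_derivative T' s) (at s)"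
    and E: "\<And>s u v. s \<in> I \<Longrightarrow>
      second_order_expansion (\<lambda>r. T r u v) (\<lambda>r. T' r u v) (\<lambda>r. T'' r u v) s"
    and cont: "(T'' \<longlongrightarrow> T'' t) (at t)"
  shows "(T' has_vector_derivative T'' t) (at t)"
  unfolding has_vector_derivative_iff_quotient
proof (rule tendstoI)
  fix e :: real assume "e > 0"
  define e2 where "e2 = e / 2"
  have e2: "e2 > 0" "e2 < e" using \<open>e > 0\<close> by (auto simp: e2_def)
  obtain d1 where d1: "d1 > 0" "ball t d1 \<subseteq> I"
    using assms(1,2) open_contains_ball by blast
  obtain d2 where d2: "d2 > 0" "\<And>s. s \<noteq> t \<Longrightarrow> dist s t < d2 \<Longrightarrow> dist (T'' s) (T'' t) < e2"
    using tendstoD[OF cont e2(1)] unfolding eventually_at by auto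
  have "dist (inverse (s - t) *\<^sub>R (T' s - T' t)) (T'' t) < e"
    if s: "s \<noteq> t" "dist s t < min d1 d2" for s
  proof -
    have seg: "x \<in> I \<and> norm (T'' x - T'' t) < e2" if "x \<in> closed_segment t s" for x
    proof -
      have "dist x t \<le> dist s t"
        using that by (metis dist_commute dist_in_closed_segment)
      then have "dist x t < d1" "dist x t < d2" using s by auto
      then show ?thesis
        using d1 d2(2)[of x] e2(1) by (cases "x = t") (auto simp: dist_commute dist_norm[symmetric])
    qed
    have "norm (T' s - T' t - (s - t) *\<^sub>R T'' t) \<le> e2 * \<bar>s - t\<bar>"
    proof (rule norm_bilinear_blinfun_le)
      fix u v :: 'a
      show "\<bar>(T' s - T' t - (s - t) *\<^sub>R T'' t) u v\<bar> \<le> e2 * \<bar>s - t\<bar> * norm u * norm v"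
      proof (cases "u = 0 \<or> v = 0")
        case True
        then show ?thesis by (auto simp: blinfun.bilinear_simps)
      next
        case False
        have "\<bar>T' s u v - T' t u v - T'' t u v * (s - t)\<bar> \<le> e2 * norm u * norm v * \<bar>s - t\<bar>"
        proof (rule deriv_increment_near_second_coefficient[where g = "\<lambda>r. T r u v" and q = "\<lambda>r. T'' r u v"])
          fix x assume x: "x \<in> closed_segment t s"
          show "((\<lambda>r. T r u v) has_real_derivative T' x u v) (at x)"
            using seg[OF x] bounded_linear.has_vector_derivative[OF
                bounded_linear_compose[OF blinfun.bounded_linear_left blinfun.bounded_linear_left] D[of x]]
            by (simp add: has_real_derivative_iff_has_vector_derivative)
          show "second_order_expansion (\<lambda>r. T r u v) (\<lambda>r. T' r u v) (\<lambda>r. T'' r u v) x"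
            using E seg[OF x] by blast
          have "\<bar>T'' x u v - T'' t u v\<bar> \<le> norm (T'' x - T'' t) * norm u * norm v"
            using abs_bilinear_blinfun_le[of "T'' x - T'' t" u v] by (simp add: blinfun.bilinear_simps)
          also have "\<dots> < e2 * norm u * norm v"
            using seg[OF x] False by simp
          finally show "\<bar>T'' x u v - T'' t u v\<bar> < e2 * norm u * norm v" .
        qed
        then show ?thesis by (simp add: blinfun.bilinear_simps ac_simps)
      qed
    qed (use e2 in simp)
    moreover have "inverse (s - t) *\<^sub>R (T' s - T' t) - T'' t
        = inverse (s - t) *\<^sub>R (T' s - T' t - (s - t) *\<^sub>R T'' t)"
      using s by (simp add: scaleR_diff_right)
    ultimately have "norm (inverse (s - t) *\<^sub>R (T' s - T' t) - T'' t) \<le> e2"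
      using s by (simp add: inverse_eq_divide pos_divide_le_eq)
    then show ?thesis using e2 by (simp add: dist_norm)
  qed
  then show "\<forall>\<^sub>F s in at t. dist (inverse (s - t) *\<^sub>R (T' s - T' t)) (T'' t) < e"
    unfolding eventually_at using d1 d2 by (intro exI[of _ "min d1 d2"]) auto
qed

lemma form_op_derivatives:
  fixes F F' F'' :: "real \<Rightarrow> 'a::real_normed_vector \<Rightarrow> 'a \<Rightarrow> real"
  assumes I: "open I" and ell: "uniformly_elliptic I F"
    and diff: "twice_differentiable_forms I F F' F''" and t: "t \<in> I"
  shows "((\<lambda>s. form_op (F s)) has_vector_derivative form_op (F' t)) (at t)"
    and "((\<lambda>s. form_op (F' s)) has_vector_derivative form_op (F'' t)) (at t)"
proof -
  obtain C where "\<And>s u v. s \<in> I \<Longrightarrow> \<bar>F s u v\<bar> \<le> C * norm u * norm v"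
    using ell unfolding uniformly_elliptic_def by blast
  then have F: "bounded_bilinear (F s)" if "s \<in> I" for s
    using ell that unfolding uniformly_elliptic_def
    by (intro bounded_bilinear_if_bilinear[of _ C]) auto
  obtain C' where "\<And>s u v. s \<in> I \<Longrightarrow>
      \<bar>F' s u v\<bar> \<le> C' * norm u * norm v \<and> \<bar>F'' s u v\<bar> \<le> C' * norm u * norm v"
    using diff unfolding twice_differentiable_forms_def by blast
  then have F': "bounded_bilinear (F' s)" and F'': "bounded_bilinear (F'' s)" if "s \<in> I" for s
    using diff that unfolding twice_differentiable_forms_def
    by (auto intro!: bounded_bilinear_if_bilinear[of _ C'])
  have near: "\<forall>\<^sub>F h in at (0::real). s + h \<in> I" if "s \<in> I" for s
  proof -
    have "((\<lambda>h. s + h) \<longlongrightarrow> s) (at 0)" by (auto intro!: tendsto_eq_intros)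
    then show ?thesis by (rule topological_tendstoD[OF _ I that])
  qed
  have D: "((\<lambda>s. form_op (F s)) has_vector_derivative form_op (F' s)) (at s)" if s: "s \<in> I" for s
    unfolding has_vector_derivative_def has_derivative_at
  proof (intro conjI bounded_linear_scaleR_left)
    have lim: "((\<lambda>h. form_norm (\<lambda>u v. F (s + h) u v - F s u v - h * F' s u v) / h) \<longlongrightarrow> 0) (at 0)"
      using diff s unfolding twice_differentiable_forms_def by blast
    have "\<forall>\<^sub>F h in at 0.
      norm (norm (form_op (F (s + h)) - form_op (F s) - h *\<^sub>R form_op (F' s)) / norm h)
        \<le> \<bar>form_norm (\<lambda>u v. F (s + h) u v - F s u v - h * F' s u v) / h\<bar>"
      using near[OF s]
    proof eventually_elim
      case (elim h)
      have "norm (form_op (F (s + h)) - form_op (F s) - h *\<^sub>R form_op (F' s))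
        \<le> form_norm (\<lambda>u v. F (s + h) u v - F s u v - h * F' s u v)"
        by (rule norm_le_form_norm)
          (simp add: blinfun.bilinear_simps F[OF elim] F[OF s] F'[OF s])
      then show ?case by (simp add: divide_right_mono)
    qed
    then show "((\<lambda>h. norm (form_op (F (s + h)) - form_op (F s) - h *\<^sub>R form_op (F' s)) / norm h)
        \<longlongrightarrow> 0) (at 0)"
      by (rule Lim_null_comparison[OF _ tendsto_rabs_zero[OF lim]])
  qed
  show "((\<lambda>s. form_op (F s)) has_vector_derivative form_op (F' t)) (at t)"
    by (rule D[OF t])
  show "((\<lambda>s. form_op (F' s)) has_vector_derivative form_op (F'' t)) (at t)"
  proof (rule has_second_derivative_if_expansion[OF I t D])
    have lim: "((\<lambda>h. form_norm (\<lambda>u v. F'' (t + h) u v - F'' t u v)) \<longlongrightarrow> 0) (at 0)"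
      using diff t unfolding twice_differentiable_forms_def by blast
    have "\<forall>\<^sub>F h in at 0. norm (form_op (F'' (t + h)) - form_op (F'' t))
        \<le> form_norm (\<lambda>u v. F'' (t + h) u v - F'' t u v)"
      using near[OF t]
    proof eventually_elim
      case (elim h)
      show ?case
        by (rule norm_le_form_norm) (simp add: blinfun.bilinear_simps F''[OF elim] F''[OF t])
    qed
    then have "((\<lambda>h. form_op (F'' (t + h)) - form_op (F'' t)) \<longlongrightarrow> 0) (at 0)"
      by (rule Lim_null_comparison[OF _ lim])
    then have "((\<lambda>h. form_op (F'' (t + h))) \<longlongrightarrow> form_op (F'' t)) (at 0)"
      by (simp add: Lim_null[symmetric])
    then show "((\<lambda>s. form_op (F'' s)) \<longlongrightarrow> form_op (F'' t)) (at t)"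
      by (rule LIM_offset_zero_cancel)
  next
    fix s u v assume s: "s \<in> I"
    let ?G = "\<lambda>h u v. F (s + h) u v - F s u v - h * F' s u v - h\<^sup>2 / 2 * F'' s u v"
    have lim: "((\<lambda>h. form_norm (?G h) / h\<^sup>2) \<longlongrightarrow> 0) (at 0)"
      using diff s unfolding twice_differentiable_forms_def by blast
    have "\<forall>\<^sub>F h in at 0. norm (?G h u v / h\<^sup>2) \<le> form_norm (?G h) / h\<^sup>2 * (norm u * norm v)"
      using near[OF s]
    proof eventually_elim
      case (elim h)
      let ?T = "form_op (F (s + h)) - form_op (F s) - h *\<^sub>R form_op (F' s) - (h\<^sup>2 / 2) *\<^sub>R form_op (F'' s)"
      have T: "?T u v = ?G h u v" for u v
        by (simp add: blinfun.bilinear_simps F[OF elim] F[OF s] F'[OF s] F''[OF s])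
      have "\<bar>?G h u v\<bar> \<le> norm ?T * norm u * norm v"
        using abs_bilinear_blinfun_le[of ?T u v] T by simp
      also have "\<dots> \<le> form_norm (?G h) * norm u * norm v"
        by (intro mult_right_mono norm_le_form_norm T) auto
      finally show ?case by (simp add: divide_right_mono mult.assoc)
    qed
    then have "((\<lambda>h. ?G h u v / h\<^sup>2) \<longlongrightarrow> 0) (at 0)"
      by (rule Lim_null_comparison) (rule tendsto_mult_left_zero[OF lim])
    moreover have "\<forall>\<^sub>F h in at 0. ?G h u v / h\<^sup>2 =
      (form_op (F (s + h)) u v - form_op (F s) u v - h * form_op (F' s) u v
          - h\<^sup>2 / 2 * form_op (F'' s) u v) / h\<^sup>2"
      using near[OF s] by eventually_elim (simp add: F F' F'' s)
    ultimately show "second_order_expansion (\<lambda>r. form_op (F r) u v)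
      (\<lambda>r. form_op (F' r) u v) (\<lambda>r. form_op (F'' r) u v) s"
      unfolding second_order_expansion_def by (rule Lim_transform_eventually)
  qed
qed

definition pullback ::
    "('v::real_normed_vector \<Rightarrow>\<^sub>L 'x::real_normed_vector) \<Rightarrow> ('x \<Rightarrow>\<^sub>L 'x \<Rightarrow>\<^sub>L real) \<Rightarrow> 'v \<Rightarrow>\<^sub>L 'v \<Rightarrow>\<^sub>L real" where
  "pullback L T = Blinfun (\<lambda>l. l o\<^sub>L L) o\<^sub>L T o\<^sub>L L"

lemma pullback_apply [simp]: "pullback L T u v = T (L u) (L v)"
  by (simp add: pullback_def bounded_linear_Blinfun_apply
      bounded_bilinear.bounded_linear_left[OF bounded_bilinear_blinfun_compose])

lemma bounded_linear_pullback: "bounded_linear (pullback L)"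
  unfolding pullback_def[abs_def]
  by (intro bounded_linear_compose[OF bounded_bilinear.bounded_linear_left[OF bounded_bilinear_blinfun_compose]]
      bounded_bilinear.bounded_linear_right[OF bounded_bilinear_blinfun_compose])

section \<open>Rayleigh quotients on orthogonal complements\<close>

text \<open>One computation serves two purposes: with \<open>m = 1\<close> it measures the distance of \<open>x\<close> to a span in the
  form \<open>B\<close>, and with \<open>m\<close> the eigenvalues it is Bessel's inequality for the form \<open>A\<close>, in which the
  eigenvectors are orthogonal but not normalised.\<close>

lemma orthogonal_remainder:
  fixes F :: "'a::real_normed_vector \<Rightarrow> 'a \<Rightarrow> real" and e :: "nat \<Rightarrow> 'a"
  assumes "bounded_bilinear F" and sym: "\<And>x y. F x y = F y x"
    and orth: "\<And>j k. F (e j) (e k) = (if j = k then m k else 0)"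
    and coeff: "\<And>k. F x (e k) = m k * c k"
  defines "r n \<equiv> x - (\<Sum>k<n. c k *\<^sub>R e k)"
  shows "k < n \<Longrightarrow> F (r n) (e k) = 0"
    and "F (r n) (r n) = F x x - (\<Sum>k<n. m k * (c k)\<^sup>2)"
proof -
  interpret F: bounded_bilinear F by fact
  show *: "F (r n) (e k) = 0" if "k < n" for k n
    using that by (simp add: r_def F.diff_left F.sum_left F.scaleR_left orth coeff if_distrib cong: if_cong)
  have "F (r n) (r n) = F (r n) x - (\<Sum>k<n. c k * F (r n) (e k))"
    by (simp add: r_def[of n] F.diff_right F.sum_right F.scaleR_right)
  also have "\<dots> = F x x - (\<Sum>k<n. c k * F (e k) x)"
    by (simp add: * ) (simp add: r_def F.diff_left F.sum_left F.scaleR_left)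
  also have "(\<Sum>k<n. c k * F (e k) x) = (\<Sum>k<n. m k * (c k)\<^sup>2)"
    by (rule sum.cong) (simp_all add: sym[of _ x] coeff power2_eq_square)
  finally show "F (r n) (r n) = F x x - (\<Sum>k<n. m k * (c k)\<^sup>2)" .
qed

text \<open>Parseval's identity, in the form of an inequality: completeness gives \<open>y\<close> in the span close to
  \<open>x\<close>, and by Pythagoras the orthogonal projection \<open>p\<close> of \<open>x\<close> is at least as close as \<open>y\<close>.\<close>

lemma complete_orthonormal_parseval:
  fixes B :: "'a::real_normed_vector \<Rightarrow> 'a \<Rightarrow> real"
  assumes B: "bounded_bilinear B" and sym: "\<And>x y. B x y = B y x"
    and nonneg: "\<And>x. B x x \<ge> 0"
    and co: "complete_orthonormal B e" and "\<epsilon> > 0"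
  shows "\<exists>n. B x x \<le> (\<Sum>k<n. (B x (e k))\<^sup>2) + \<epsilon>"
proof -
  interpret B: bounded_bilinear B by fact
  obtain K where K: "\<And>u v. norm (B u v) \<le> norm u * norm v * K" "K > 0"
    using B.pos_bounded by blast
  have "x \<in> closure (span (range e))"
    using co by (simp add: complete_orthonormal_def)
  then obtain y where y: "y \<in> span (range e)" "dist y x < sqrt (\<epsilon> / K)"
    using \<open>\<epsilon> > 0\<close> K(2) unfolding closure_approachable by (metis divide_pos_pos real_sqrt_gt_zero)
  (* Elements of the span are characterised by what is orthogonal to them, which avoids
     handling their coefficients. *)
  have "\<exists>n. \<forall>z. (\<forall>k<n. B z (e k) = 0) \<longrightarrow> B z y = 0"
    using y(1)
  proof (rule span_induct)
    show "subspace {y. \<exists>n. \<forall>z. (\<forall>k<n. B z (e k) = 0) \<longrightarrow> B z y = 0}"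
    proof (rule subspaceI)
      fix p q
      assume "p \<in> {y. \<exists>n. \<forall>z. (\<forall>k<n. B z (e k) = 0) \<longrightarrow> B z y = 0}"
        "q \<in> {y. \<exists>n. \<forall>z. (\<forall>k<n. B z (e k) = 0) \<longrightarrow> B z y = 0}"
      then obtain m n where "\<forall>z. (\<forall>k<m. B z (e k) = 0) \<longrightarrow> B z p = 0"
        "\<forall>z. (\<forall>k<n. B z (e k) = 0) \<longrightarrow> B z q = 0" by blast
      then have "\<forall>z. (\<forall>k<max m n. B z (e k) = 0) \<longrightarrow> B z (p + q) = 0"
        by (simp add: B.add_right)
      then show "p + q \<in> {y. \<exists>n. \<forall>z. (\<forall>k<n. B z (e k) = 0) \<longrightarrow> B z y = 0}" by blast
    next
      fix c p
      assume "p \<in> {y. \<exists>n. \<forall>z. (\<forall>k<n. B z (e k) = 0) \<longrightarrow> B z y = 0}"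
      then show "c *\<^sub>R p \<in> {y. \<exists>n. \<forall>z. (\<forall>k<n. B z (e k) = 0) \<longrightarrow> B z y = 0}"
        by (auto simp: B.scaleR_right)
    qed (auto simp: B.zero_right)
    show "\<exists>n. \<forall>z. (\<forall>k<n. B z (e k) = 0) \<longrightarrow> B z w = 0" if "w \<in> range e" for w
      using that by auto
  qed
  then obtain n where n: "\<And>z. (\<And>k. k < n \<Longrightarrow> B z (e k) = 0) \<Longrightarrow> B z y = 0" by blast
  define p where "p = (\<Sum>k<n. B x (e k) *\<^sub>R e k)"
  have orth: "B (e j) (e k) = (if j = k then 1 else 0)" for j k
    using co by (simp add: complete_orthonormal_def)
  note rem = orthogonal_remainder[OF B sym, where e = e and m = "\<lambda>_. 1" and c = "\<lambda>k. B x (e k)" and x = x and n = n,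
      OF orth, simplified, folded p_def]
  have "B (x - p) (p - y) = 0"
    using n[of "x - p"] rem(1)
    by (simp add: B.diff_right B.sum_right B.scaleR_right p_def)
  moreover have "x - y = (x - p) + (p - y)" by simp
  ultimately have "B (x - y) (x - y) = B (x - p) (x - p) + B (p - y) (p - y)"
    by (simp only: B.add_left B.add_right sym[of "p - y" "x - p"])
  then have "B (x - p) (x - p) \<le> B (x - y) (x - y)" using nonneg[of "p - y"] by simp
  also have "\<dots> \<le> (norm (x - y))\<^sup>2 * K" using K(1)[of "x - y" "x - y"] by (simp add: power2_eq_square)
  also have "\<dots> \<le> (sqrt (\<epsilon> / K))\<^sup>2 * K"
    using y(2) K(2) by (intro mult_right_mono power_mono) (auto simp: dist_norm norm_minus_commute)
  also have "\<dots> = \<epsilon>" using K(2) \<open>\<epsilon> > 0\<close> by simp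
  finally show ?thesis using rem(2) by (intro exI[of _ n]) simp
qed

text \<open>Parseval in \<open>B\<close> and Bessel in \<open>A\<close> compare the two forms coefficient by coefficient. For \<open>N = 0\<close>
  this is the variational characterisation of the first eigenvalue; for \<open>N = 1\<close> it is the spectral
  gap above a simple first eigenvalue. Density in the larger space alone would not suffice, since
  approximating \<open>J v\<close> there says nothing about \<open>A v v\<close>; Bessel's inequality is what replaces it.\<close>

lemma eigenvalue_le_rayleigh_quotient:
  fixes J :: "'v::real_normed_vector \<Rightarrow> 'x::real_normed_vector"
  assumes A: "bounded_bilinear A" and Asym: "\<And>u v. A u v = A v u" and Anonneg: "\<And>u. A u u \<ge> 0"
    and B: "bounded_bilinear B" and Bsym: "\<And>x y. B x y = B y x" and Bnonneg: "\<And>x. B x x \<ge> 0"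
    and eig: "eigensystem J A B \<mu> w"
    and orth: "\<And>k. k < N \<Longrightarrow> B (J v) (J (w k)) = 0"
  shows "\<mu> N * B (J v) (J v) \<le> A v v"
proof (rule field_le_epsilon)
  fix \<epsilon> :: real assume "\<epsilon> > 0"
  have pair: "A (w k) z = \<mu> k * B (J (w k)) (J z)" for k z
    using eig by (simp add: eigensystem_def eigenpair_def)
  have co: "complete_orthonormal B (\<lambda>k. J (w k))" and mono: "mono \<mu>" and "\<mu> 0 > 0"
    using eig by (auto simp: eigensystem_def)
  then have pos: "\<mu> k > 0" for k
    using monoD[OF mono, of 0 k] by simp
  define c where "c k = B (J v) (J (w k))" for k
  have coeff: "A v (w k) = \<mu> k * c k" for k
    using pair[of k v] Asym[of v "w k"] Bsym by (simp add: c_def)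
  have "A (w j) (w k) = (if j = k then \<mu> k else 0)" for j k
    using co pair[of j "w k"] by (simp add: complete_orthonormal_def)
  note rem = orthogonal_remainder(2)[OF A Asym this coeff]
  obtain n where n: "B (J v) (J v) \<le> (\<Sum>k<n. (c k)\<^sup>2) + \<epsilon> / \<mu> N"
    using complete_orthonormal_parseval[OF B Bsym Bnonneg co, of "\<epsilon> / \<mu> N" "J v"] \<open>\<epsilon> > 0\<close> pos
    by (auto simp: c_def)
  have "\<mu> N * B (J v) (J v) \<le> \<mu> N * ((\<Sum>k<n. (c k)\<^sup>2) + \<epsilon> / \<mu> N)"
    using n pos[of N] by (intro mult_left_mono) auto
  also have "\<dots> = (\<Sum>k<n. \<mu> N * (c k)\<^sup>2) + \<epsilon>"
    using pos[of N] by (simp add: distrib_left sum_distrib_left)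
  also have "(\<Sum>k<n. \<mu> N * (c k)\<^sup>2) \<le> (\<Sum>k<n. \<mu> k * (c k)\<^sup>2)"
  proof (rule sum_mono)
    fix k
    show "\<mu> N * (c k)\<^sup>2 \<le> \<mu> k * (c k)\<^sup>2"
      using orth[of k] monoD[OF mono, of N k] by (cases "k < N") (auto simp: c_def intro: mult_right_mono)
  qed
  also have "(\<Sum>k<n. \<mu> k * (c k)\<^sup>2) \<le> A v v"
    using Anonneg[of "v - (\<Sum>k<n. c k *\<^sub>R w k)"] rem[of n] by simp
  finally show "\<mu> N * B (J v) (J v) \<le> A v v + \<epsilon>" by simp
qed

section \<open>Differentiating a simple extremal eigenvalue twice\<close>

text \<open>An operator bounded below reflects Cauchy filters, hence convergence. This is how the derivative
  of the eigenvector is found, with no equation having to be solved for it.\<close>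

lemma convergent_if_image_convergent:
  fixes T :: "'a::{real_normed_vector, complete_space} \<Rightarrow>\<^sub>L 'b::real_normed_vector"
  assumes S: "subspace S" and g: "g > 0" "\<And>x. x \<in> S \<Longrightarrow> g * norm x \<le> norm (T x)"
    and W: "\<forall>\<^sub>F s in F. W s \<in> S" and lim: "((\<lambda>s. T (W s)) \<longlongrightarrow> y) F" and F: "F \<noteq> bot"
  shows "\<exists>w. (W \<longlongrightarrow> w) F"
proof -
  have "cauchy_filter (filtermap W F)"
    unfolding cauchy_filter_metric_filtermap
  proof (intro allI impI)
    fix e :: real assume "e > 0"
    then have "\<forall>\<^sub>F s in F. dist (T (W s)) y < g * e / 2"
      using g(1) by (intro tendstoD[OF lim]) auto
    with W have "\<forall>\<^sub>F s in F. W s \<in> S \<and> dist (T (W s)) y < g * e / 2"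
      by eventually_elim simp
    moreover have "dist (W r) (W s) < e"
      if "W r \<in> S" "dist (T (W r)) y < g * e / 2" "W s \<in> S" "dist (T (W s)) y < g * e / 2" for r s
    proof -
      have "g * norm (W r - W s) \<le> norm (T (W r - W s))"
        using that by (intro g(2) subspace_diff[OF S])
      also have "\<dots> = dist (T (W r)) (T (W s))"
        by (simp add: dist_norm blinfun.diff_right)
      also have "\<dots> < g * e" using that dist_triangle_half_l by blast
      finally show ?thesis using g(1) by (simp add: dist_norm)
    qed
    ultimately show "\<exists>P. eventually P F \<and> (\<forall>r s. P r \<and> P s \<longrightarrow> dist (W r) (W s) < e)"
      by (intro exI[of _ "\<lambda>s. W s \<in> S \<and> dist (T (W s)) y < g * e / 2"]) auto
  qed
  then obtain w where "filtermap W F \<le> nhds w"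
    using cauchy_filter_complete_converges[OF _ complete_UNIV, of "filtermap W F"] F
    by (auto simp: filtermap_bot_iff)
  then show ?thesis by (auto simp: filterlim_def)
qed

text \<open>The eigenvalue problem is inverted: \<open>f = 1 / \<lambda>\<^sub>1\<close> is the largest eigenvalue of \<open>b\<close> relative to the
  inner product \<open>a\<close>. This makes \<open>f\<close> the maximum of a Rayleigh quotient, and the spectral gap becomes
  coercivity of \<open>f * a - b\<close> on the complement of the eigenvector.\<close>

locale simple_top_eigenvalue =
  fixes I :: "real set"
    and a b a' b' :: "real \<Rightarrow> 'v::{real_normed_vector, complete_space} \<Rightarrow>\<^sub>L 'v \<Rightarrow>\<^sub>L real"
    and f :: "real \<Rightarrow> real" and \<phi> :: "real \<Rightarrow> 'v" and \<delta> :: real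
  assumes open_I: "open I"
    and a_deriv: "\<And>s. s \<in> I \<Longrightarrow> (a has_vector_derivative a' s) (at s)"
    and b_deriv: "\<And>s. s \<in> I \<Longrightarrow> (b has_vector_derivative b' s) (at s)"
    and a_sym: "\<And>s u v. s \<in> I \<Longrightarrow> a s u v = a s v u"
    and b_sym: "\<And>s u v. s \<in> I \<Longrightarrow> b s u v = b s v u"
    and \<delta>_pos: "\<delta> > 0"
    and coercive: "\<And>s v. s \<in> I \<Longrightarrow> \<delta> * (norm v)\<^sup>2 \<le> a s v v"
    and eigenvector: "\<And>s v. s \<in> I \<Longrightarrow> b s (\<phi> s) v = f s * a s (\<phi> s) v"
    and eigenvector_nonzero: "\<And>s. s \<in> I \<Longrightarrow> \<phi> s \<noteq> 0"
    and top: "\<And>s v. s \<in> I \<Longrightarrow> b s v v \<le> f s * a s v v"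
    and gap: "\<And>s. s \<in> I \<Longrightarrow>
      \<exists>g>0. \<forall>v. a s (\<phi> s) v = 0 \<longrightarrow> g * (norm v)\<^sup>2 \<le> f s * a s v v - b s v v"
begin

lemma a_pos: "s \<in> I \<Longrightarrow> v \<noteq> 0 \<Longrightarrow> a s v v > 0"
  using coercive[of s v] \<delta>_pos by (smt (verit) zero_less_mult_iff zero_less_power zero_less_norm_iff)

lemma a_tendsto: "s \<in> I \<Longrightarrow> (a \<longlongrightarrow> a s) (at s)"
  and b_tendsto: "s \<in> I \<Longrightarrow> (b \<longlongrightarrow> b s) (at s)"
  using has_vector_derivative_continuous[OF a_deriv] has_vector_derivative_continuous[OF b_deriv]
  by (simp_all add: continuous_within)

lemma eventually_I: "t \<in> I \<Longrightarrow> \<forall>\<^sub>F s in at t. s \<in> I"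
  using open_I by (rule eventually_at_in_open')

text \<open>Each eigenvector is a test vector for the Rayleigh quotient at the other parameter, which gives
  one of the two inequalities each.\<close>

lemma eigenvalue_increment:
  assumes s: "s \<in> I" and t: "t \<in> I"
  shows "\<bar>f s - f t\<bar> \<le> norm (b s - b t - f t *\<^sub>R (a s - a t)) / \<delta>"
proof -
  let ?K = "b s - b t - f t *\<^sub>R (a s - a t)"
  have K: "?K u u = b s u u - b t u u - f t * (a s u u - a t u u)" for u
    by (simp add: blinfun.bilinear_simps)
  have bound: "\<bar>?K u u\<bar> \<le> norm ?K / \<delta> * a s u u" for u
  proof -
    have "\<bar>?K u u\<bar> \<le> norm ?K * (norm u)\<^sup>2"
      using abs_bilinear_blinfun_le[of ?K u u] by (simp add: power2_eq_square)
    also have "\<dots> = norm ?K / \<delta> * (\<delta> * (norm u)\<^sup>2)" using \<delta>_pos by simp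
    also have "\<dots> \<le> norm ?K / \<delta> * a s u u"
      using \<delta>_pos by (intro mult_left_mono coercive s) auto
    finally show ?thesis .
  qed
  have "(f s - f t) * a s (\<phi> s) (\<phi> s) \<le> ?K (\<phi> s) (\<phi> s)"
    using top[OF t, of "\<phi> s"] eigenvector[OF s, of "\<phi> s"] K[of "\<phi> s"] by (simp add: algebra_simps)
  also have "\<dots> \<le> norm ?K / \<delta> * a s (\<phi> s) (\<phi> s)"
    using bound[of "\<phi> s"] by linarith
  finally have "f s - f t \<le> norm ?K / \<delta>"
    using a_pos[OF s eigenvector_nonzero[OF s]] by (rule mult_right_le_imp_le)
  moreover
  have "?K (\<phi> t) (\<phi> t) \<le> (f s - f t) * a s (\<phi> t) (\<phi> t)"
    using top[OF s, of "\<phi> t"] eigenvector[OF t, of "\<phi> t"] K[of "\<phi> t"] by (simp add: algebra_simps)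
  then have "(- (norm ?K / \<delta>)) * a s (\<phi> t) (\<phi> t) \<le> (f s - f t) * a s (\<phi> t) (\<phi> t)"
    using bound[of "\<phi> t"] by linarith
  then have "- (norm ?K / \<delta>) \<le> f s - f t"
    using a_pos[OF s eigenvector_nonzero[OF t]] by (rule mult_right_le_imp_le)
  ultimately show ?thesis by (simp add: abs_le_iff)
qed

lemma eigenvalue_tendsto:
  assumes t: "t \<in> I"
  shows "(f \<longlongrightarrow> f t) (at t)"
proof -
  have "\<forall>\<^sub>F s in at t. norm (f s - f t) \<le> norm (b s - b t - f t *\<^sub>R (a s - a t)) / \<delta>"
    using eventually_I[OF t] by eventually_elim (simp add: eigenvalue_increment t)
  moreover have "((\<lambda>s. norm (b s - b t - f t *\<^sub>R (a s - a t)) / \<delta>) \<longlongrightarrow> 0) (at t)"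
    by (rule tendsto_eq_intros a_tendsto b_tendsto t | simp add: \<delta>_pos[THEN less_imp_neq, symmetric])+
  ultimately have "((\<lambda>s. f s - f t) \<longlongrightarrow> 0) (at t)"
    by (rule Lim_null_comparison)
  then show ?thesis by (simp add: Lim_null[symmetric])
qed

text \<open>This form is positive semidefinite, and its kernel is spanned by the eigenvector.\<close>

definition M where "M s = f s *\<^sub>R a s - b s"

lemma M_apply: "M s u v = f s * a s u v - b s u v"
  by (simp add: M_def blinfun.bilinear_simps)

lemma M_eigenvector: "s \<in> I \<Longrightarrow> M s (\<phi> s) = 0"
  by (rule blinfun_eqI) (simp add: M_apply eigenvector)

lemma M_tendsto: "t \<in> I \<Longrightarrow> (M \<longlongrightarrow> M t) (at t)"
  unfolding M_def by (intro tendsto_intros a_tendsto b_tendsto eigenvalue_tendsto)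

text \<open>The eigenvectors \<open>\<phi> s\<close> are chosen independently at each parameter, so even their sign may jump.
  Near \<open>t\<close> they are rescaled so that their component along \<open>\<phi> t\<close> is exactly \<open>\<phi> t\<close>; then
  \<open>\<psi> t s - \<phi> t\<close> lies in the complement on which \<open>M t\<close> is coercive.\<close>

definition \<psi> where "\<psi> t s = (a t (\<phi> t) (\<phi> t) / a t (\<phi> t) (\<phi> s)) *\<^sub>R \<phi> s"

lemma \<psi>_same: "t \<in> I \<Longrightarrow> \<psi> t t = \<phi> t"
  using a_pos[of t "\<phi> t"] eigenvector_nonzero[of t] by (simp add: \<psi>_def)

lemma \<psi>_eigenvector: "s \<in> I \<Longrightarrow> b s (\<psi> t s) v = f s * a s (\<psi> t s) v"
  by (simp add: \<psi>_def blinfun.bilinear_simps eigenvector)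

lemma M_\<psi>: "s \<in> I \<Longrightarrow> M s (\<psi> t s) = 0"
  by (simp add: \<psi>_def M_eigenvector blinfun.bilinear_simps)

text \<open>The component \<open>w\<close> of \<open>\<phi> s\<close> orthogonal to \<open>\<phi> t\<close> is small: \<open>M t\<close> is coercive on it, while
  \<open>M t (\<phi> s)\<close> differs from \<open>M s (\<phi> s) = 0\<close> only by the increment of \<open>M\<close>.\<close>

lemma eigenvector_component:
  assumes t: "t \<in> I" and s: "s \<in> I" and g: "g > 0"
    and gap_t: "\<And>v. a t (\<phi> t) v = 0 \<Longrightarrow> g * (norm v)\<^sup>2 \<le> M t v v"
  defines "c \<equiv> a t (\<phi> t) (\<phi> s) / a t (\<phi> t) (\<phi> t)"
  shows "norm (\<phi> s - c *\<^sub>R \<phi> t) \<le> norm (M s - M t) / g * norm (\<phi> s)"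
proof (cases "\<phi> s - c *\<^sub>R \<phi> t = 0")
  case False
  define w where "w = \<phi> s - c *\<^sub>R \<phi> t"
  have "a t (\<phi> t) w = 0"
    using a_pos[OF t eigenvector_nonzero[OF t]] by (simp add: w_def c_def blinfun.bilinear_simps)
  then have "g * (norm w)\<^sup>2 \<le> M t w w" by (rule gap_t)
  also have "\<dots> = - ((M s - M t) (\<phi> s) w)"
    by (simp add: w_def blinfun.bilinear_simps M_eigenvector s t)
  also have "\<dots> \<le> norm (M s - M t) * norm (\<phi> s) * norm w"
    using abs_bilinear_blinfun_le[of "M s - M t" "\<phi> s" w] by linarith
  finally have "(g * norm w) * norm w \<le> (norm (M s - M t) * norm (\<phi> s)) * norm w"
    by (simp add: power2_eq_square mult.assoc)
  then have "g * norm w \<le> norm (M s - M t) * norm (\<phi> s)"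
    using False by (simp add: w_def)
  then show ?thesis using g by (simp add: w_def[symmetric] field_simps)
qed (use g in simp)

lemma \<psi>_tendsto:
  assumes t: "t \<in> I"
  shows "\<forall>\<^sub>F s in at t. a t (\<phi> t) (\<phi> s) \<noteq> 0" and "(\<psi> t \<longlongrightarrow> \<phi> t) (at t)"
proof -
  obtain g where g: "g > 0" and gap_t: "\<And>v. a t (\<phi> t) v = 0 \<Longrightarrow> g * (norm v)\<^sup>2 \<le> M t v v"
    using gap[OF t] unfolding M_apply by blast
  define \<eta> where "\<eta> s = norm (M s - M t) / g" for s
  have \<eta>: "(\<eta> \<longlongrightarrow> 0) (at t)"
    unfolding \<eta>_def
    by (rule tendsto_eq_intros M_tendsto t | simp add: g[THEN less_imp_neq, symmetric])+
  have att: "a t (\<phi> t) (\<phi> t) > 0" using a_pos[OF t eigenvector_nonzero[OF t]] .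
  have "\<forall>\<^sub>F s in at t. dist (\<eta> s) 0 < 1/2" by (rule tendstoD[OF \<eta>]) simp
  then have ev: "\<forall>\<^sub>F s in at t. a t (\<phi> t) (\<phi> s) \<noteq> 0 \<and> norm (\<psi> t s - \<phi> t) \<le> \<eta> s * (2 * norm (\<phi> t))"
    using eventually_I[OF t]
  proof eventually_elim
    case (elim s)
    define c where "c = a t (\<phi> t) (\<phi> s) / a t (\<phi> t) (\<phi> t)"
    have w: "norm (\<phi> s - c *\<^sub>R \<phi> t) \<le> \<eta> s * norm (\<phi> s)"
      unfolding \<eta>_def c_def by (rule eigenvector_component[OF t elim(2) g gap_t])
    have "\<eta> s * norm (\<phi> s) \<le> 1/2 * norm (\<phi> s)"
      using elim(1) by (intro mult_right_mono) auto
    then have "norm (\<phi> s) \<le> 2 * (\<bar>c\<bar> * norm (\<phi> t))"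
      using w norm_triangle_sub[of "\<phi> s" "c *\<^sub>R \<phi> t"] by simp
    moreover have "norm (\<phi> s) > 0" using eigenvector_nonzero[OF elim(2)] by simp
    ultimately have c: "c \<noteq> 0" by auto
    then have c2: "norm (\<phi> s) / \<bar>c\<bar> \<le> 2 * norm (\<phi> t)"
      using \<open>norm (\<phi> s) \<le> 2 * (\<bar>c\<bar> * norm (\<phi> t))\<close> by (simp add: pos_divide_le_eq ac_simps)
    have "\<psi> t s - \<phi> t = (1 / c) *\<^sub>R (\<phi> s - c *\<^sub>R \<phi> t)"
      using c by (simp add: \<psi>_def c_def scaleR_diff_right)
    then have "norm (\<psi> t s - \<phi> t) = norm (\<phi> s - c *\<^sub>R \<phi> t) / \<bar>c\<bar>" by simp
    also have "\<dots> \<le> \<eta> s * norm (\<phi> s) / \<bar>c\<bar>" by (intro divide_right_mono w) simp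
    also have "\<dots> = \<eta> s * (norm (\<phi> s) / \<bar>c\<bar>)" by simp
    also have "\<dots> \<le> \<eta> s * (2 * norm (\<phi> t))"
      by (intro mult_left_mono c2) (use g in \<open>simp add: \<eta>_def\<close>)
    finally show ?case using c by (simp add: c_def)
  qed
  show "\<forall>\<^sub>F s in at t. a t (\<phi> t) (\<phi> s) \<noteq> 0" using ev by eventually_elim simp
  have "((\<lambda>s. \<eta> s * (2 * norm (\<phi> t))) \<longlongrightarrow> 0) (at t)"
    by (rule tendsto_mult_left_zero[OF \<eta>])
  moreover have "\<forall>\<^sub>F s in at t. norm (\<psi> t s - \<phi> t) \<le> \<eta> s * (2 * norm (\<phi> t))"
    using ev by eventually_elim simp
  ultimately have "((\<lambda>s. \<psi> t s - \<phi> t) \<longlongrightarrow> 0) (at t)" by (rule Lim_null_comparison[rotated])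
  then show "(\<psi> t \<longlongrightarrow> \<phi> t) (at t)" by (simp add: Lim_null[symmetric])
qed

text \<open>The first-order perturbation formula for the eigenvalue; it is unchanged by rescaling \<open>\<phi> t\<close>.\<close>

definition Df where "Df t = (b' t - f t *\<^sub>R a' t) (\<phi> t) (\<phi> t) / a t (\<phi> t) (\<phi> t)"

text \<open>Testing the eigenvalue equation at \<open>s\<close> with \<open>\<phi> t\<close> and the one at \<open>t\<close> with \<open>\<psi> t s\<close>, and subtracting,
  expresses \<open>f s - f t\<close> exactly through the increments of \<open>a\<close> and \<open>b\<close>. Only continuity of the
  eigenvector is then needed to pass to the limit.\<close>

lemma eigenvalue_deriv:
  assumes t: "t \<in> I"
  shows "(f has_real_derivative Df t) (at t)"
  unfolding has_field_derivative_iff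
proof (rule Lim_transform_eventually)
  let ?Q = "\<lambda>x s. inverse (s - t) *\<^sub>R (x s - x t)"
  have Qa: "(?Q a \<longlongrightarrow> a' t) (at t)" and Qb: "(?Q b \<longlongrightarrow> b' t) (at t)"
    using a_deriv[OF t] b_deriv[OF t] by (simp_all add: has_vector_derivative_iff_quotient)
  have att: "a t (\<phi> t) (\<phi> t) > 0" using a_pos[OF t eigenvector_nonzero[OF t]] .
  have den: "((\<lambda>s. a s (\<psi> t s) (\<phi> t)) \<longlongrightarrow> a t (\<phi> t) (\<phi> t)) (at t)"
    by (intro tendsto_intros a_tendsto \<psi>_tendsto t)
  show "((\<lambda>s. (?Q b s - f t *\<^sub>R ?Q a s) (\<psi> t s) (\<phi> t) / a s (\<psi> t s) (\<phi> t)) \<longlongrightarrow> Df t) (at t)"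
    unfolding Df_def by (intro tendsto_intros den Qa Qb \<psi>_tendsto t) (use att in simp)
  have "\<forall>\<^sub>F s in at t. a s (\<psi> t s) (\<phi> t) \<noteq> 0"
    using att by (intro tendsto_imp_eventually_ne[OF den]) simp
  then show "\<forall>\<^sub>F s in at t. (?Q b s - f t *\<^sub>R ?Q a s) (\<psi> t s) (\<phi> t) / a s (\<psi> t s) (\<phi> t)
      = (f s - f t) / (s - t)"
    using eventually_I[OF t]
  proof eventually_elim
    case (elim s)
    have 1: "b s (\<psi> t s) (\<phi> t) = f s * a s (\<psi> t s) (\<phi> t)"
      by (rule \<psi>_eigenvector[OF elim(2)])
    have 2: "b t (\<psi> t s) (\<phi> t) = f t * a t (\<psi> t s) (\<phi> t)"
      using eigenvector[OF t, of "\<psi> t s"] a_sym[OF t] b_sym[OF t] by simp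
    have "(?Q b s - f t *\<^sub>R ?Q a s) (\<psi> t s) (\<phi> t)
        = inverse (s - t) * (b s (\<psi> t s) (\<phi> t) - b t (\<psi> t s) (\<phi> t)
            - f t * (a s (\<psi> t s) (\<phi> t) - a t (\<psi> t s) (\<phi> t)))"
      by (simp add: blinfun.bilinear_simps algebra_simps)
    also have "\<dots> = inverse (s - t) * ((f s - f t) * a s (\<psi> t s) (\<phi> t))"
      unfolding 1 2 by (simp add: algebra_simps)
    finally show ?case using elim(1) by (simp add: divide_inverse)
  qed
qed

definition M' where "M' t = Df t *\<^sub>R a t + f t *\<^sub>R a' t - b' t"

lemma M_deriv: "t \<in> I \<Longrightarrow> (M has_vector_derivative M' t) (at t)"
  unfolding M_def[abs_def] M'_def
  by (auto intro!: derivative_eq_intros a_deriv b_deriv eigenvalue_deriv)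

text \<open>Since \<open>M s (\<psi> t s) = 0\<close> and \<open>M t (\<phi> t) = 0\<close>, the difference quotient \<open>W\<close> of the eigenvector satisfies
  \<open>M t (W s) = - ((M s - M t) / (s - t)) (\<psi> t s)\<close>, whose right-hand side converges. As \<open>M t\<close> is bounded
  below on the complement containing \<open>W s\<close>, the quotient itself converges.\<close>

lemma \<psi>_deriv:
  assumes t: "t \<in> I"
  shows "\<exists>w. (\<psi> t has_vector_derivative w) (at t) \<and> a t (\<phi> t) w = 0 \<and> M t w = - M' t (\<phi> t)"
proof -
  define W where "W s = inverse (s - t) *\<^sub>R (\<psi> t s - \<psi> t t)" for s
  define S where "S = {v. a t (\<phi> t) v = 0}"
  obtain g where g: "g > 0" and gap_t: "\<And>v. v \<in> S \<Longrightarrow> g * (norm v)\<^sup>2 \<le> M t v v"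
    using gap[OF t] unfolding M_apply S_def by blast
  have att: "a t (\<phi> t) (\<phi> t) > 0" using a_pos[OF t eigenvector_nonzero[OF t]] .
  have "((\<lambda>s. - (inverse (s - t) *\<^sub>R (M s - M t)) (\<psi> t s)) \<longlongrightarrow> - M' t (\<phi> t)) (at t)"
    using M_deriv[OF t, unfolded has_vector_derivative_iff_quotient]
    by (intro tendsto_intros \<psi>_tendsto t)
  moreover have "\<forall>\<^sub>F s in at t. - (inverse (s - t) *\<^sub>R (M s - M t)) (\<psi> t s) = M t (W s)"
    using eventually_I[OF t]
    by eventually_elim (simp add: W_def \<psi>_same t M_eigenvector M_\<psi> blinfun.bilinear_simps)
  ultimately have lim: "((\<lambda>s. M t (W s)) \<longlongrightarrow> - M' t (\<phi> t)) (at t)"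
    by (rule Lim_transform_eventually)
  have S: "\<forall>\<^sub>F s in at t. W s \<in> S"
    using \<psi>_tendsto(1)[OF t]
    by eventually_elim (simp add: W_def S_def \<psi>_same t blinfun.bilinear_simps, simp add: \<psi>_def blinfun.bilinear_simps)
  have "\<exists>w. (W \<longlongrightarrow> w) (at t)"
  proof (rule convergent_if_image_convergent[OF _ g _ S lim])
    show "subspace S" by (auto simp: S_def subspace_def blinfun.bilinear_simps)
    fix v assume "v \<in> S"
    have "g * (norm v)\<^sup>2 \<le> M t v v" by (rule gap_t) fact
    also have "\<dots> \<le> norm (M t v) * norm v"
      using norm_blinfun[of "M t v" v] by simp
    finally show "g * norm v \<le> norm (M t v)"
      by (cases "v = 0") (auto simp: power2_eq_square mult.assoc[symmetric])
  qed simp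
  then obtain w where w: "(W \<longlongrightarrow> w) (at t)" by blast
  have "(\<psi> t has_vector_derivative w) (at t)"
    using w unfolding has_vector_derivative_iff_quotient W_def .
  moreover have "((\<lambda>s. M t (W s)) \<longlongrightarrow> M t w) (at t)"
    by (intro tendsto_intros w)
  then have "M t w = - M' t (\<phi> t)"
    using tendsto_unique[OF _ _ lim] by simp
  moreover have "((\<lambda>s. a t (\<phi> t) (W s)) \<longlongrightarrow> a t (\<phi> t) w) (at t)"
    by (intro tendsto_intros w)
  then have "((\<lambda>s. 0) \<longlongrightarrow> a t (\<phi> t) w) (at t)"
    by (rule Lim_transform_eventually) (use S in \<open>simp add: S_def\<close>)
  then have "a t (\<phi> t) w = 0"
    using tendsto_unique[OF _ _ tendsto_const[of 0 "at t"]] by fastforce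
  ultimately show ?thesis by blast
qed

text \<open>By scale invariance the formula for \<open>Df\<close> may be evaluated along the differentiable branch \<open>\<psi> t\<close>
  instead of the arbitrary choice \<open>\<phi>\<close>.\<close>

lemma Df_\<psi>:
  assumes "s \<in> I" "a t (\<phi> t) (\<phi> s) \<noteq> 0" "t \<in> I"
  shows "Df s = (b' s - f s *\<^sub>R a' s) (\<psi> t s) (\<psi> t s) / a s (\<psi> t s) (\<psi> t s)"
  using assms(2) a_pos[OF assms(3) eigenvector_nonzero[OF assms(3)]]
  by (simp add: Df_def \<psi>_def blinfun.bilinear_simps)

lemma bilinear_deriv_at_eigenvector:
  fixes T :: "real \<Rightarrow> 'v \<Rightarrow>\<^sub>L 'v \<Rightarrow>\<^sub>L real"
  assumes "t \<in> I" "(T has_vector_derivative T') (at t)" "(\<psi> t has_vector_derivative w) (at t)"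
  shows "((\<lambda>s. T s (\<psi> t s) (\<psi> t s)) has_real_derivative
    T' (\<phi> t) (\<phi> t) + T t w (\<phi> t) + T t (\<phi> t) w) (at t)"
  using blinfun.has_vector_derivative[OF blinfun.has_vector_derivative[OF assms(2,3)] assms(3)]
  by (simp add: has_real_derivative_iff_has_vector_derivative \<psi>_same assms(1) blinfun.bilinear_simps
      add.commute add.left_commute)

lemma derivative_form_sym:
  fixes T :: "real \<Rightarrow> 'v \<Rightarrow>\<^sub>L 'v \<Rightarrow>\<^sub>L real"
  assumes "t \<in> I" "(T has_vector_derivative T') (at t)" "\<And>s. s \<in> I \<Longrightarrow> T s u v = T s v u"
  shows "T' u v = T' v u"
proof -
  have D: "((\<lambda>s. T s x y) has_vector_derivative T' x y) (at t)" for x y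
    by (rule bounded_linear.has_vector_derivative[OF
          bounded_linear_compose[OF blinfun.bounded_linear_left blinfun.bounded_linear_left] assms(2)])
  have "((\<lambda>s. T s u v) has_vector_derivative T' v u) (at t)"
    by (rule has_vector_derivative_transform_within_open[OF D open_I assms(1)]) (simp add: assms(3))
  then show ?thesis using D vector_derivative_unique_at by blast
qed

text \<open>Differentiating \<open>Df s * a s (\<psi> t s) (\<psi> t s) = (b' s - f s * a' s) (\<psi> t s) (\<psi> t s)\<close> at \<open>t\<close> produces the
  explicit terms below and twice \<open>(b' t - f t * a' t) (\<phi> t) w\<close>, where \<open>w\<close> is the derivative of the
  eigenvector. By the equation for \<open>w\<close> the latter is \<open>2 * M t w w\<close>, which is nonnegative because \<open>f t\<close>
  is the largest eigenvalue.\<close>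

lemma eigenvalue_second_deriv:
  assumes t: "t \<in> I" and a2: "(a' has_vector_derivative a'') (at t)"
    and b2: "(b' has_vector_derivative b'') (at t)"
  shows "\<exists>D. (Df has_real_derivative D) (at t) \<and>
    (b'' (\<phi> t) (\<phi> t) - f t * a'' (\<phi> t) (\<phi> t) - 2 * Df t * a' t (\<phi> t) (\<phi> t))
      \<le> D * a t (\<phi> t) (\<phi> t)"
proof -
  obtain w where w: "(\<psi> t has_vector_derivative w) (at t)"
    and aw: "a t (\<phi> t) w = 0" and Mw: "M t w = - M' t (\<phi> t)"
    using \<psi>_deriv[OF t] by blast
  have att: "a t (\<phi> t) (\<phi> t) > 0" using a_pos[OF t eigenvector_nonzero[OF t]] .
  define P where "P s = b' s - f s *\<^sub>R a' s" for s
  define P' where "P' = b'' - (f t *\<^sub>R a'' + Df t *\<^sub>R a' t)"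
  have DP: "(P has_vector_derivative P') (at t)"
    unfolding P_def[abs_def] P'_def
    by (auto intro!: derivative_eq_intros a2 b2 eigenvalue_deriv t)
  have aw': "a t w (\<phi> t) = 0" using aw a_sym[OF t] by simp
  have Psym: "P t w (\<phi> t) = P t (\<phi> t) w"
    using derivative_form_sym[OF t a_deriv[OF t] a_sym] derivative_form_sym[OF t b_deriv[OF t] b_sym]
    by (simp add: P_def blinfun.bilinear_simps)
  have Pw: "P t (\<phi> t) w = M t w w"
    using Mw aw by (simp add: M'_def P_def blinfun.bilinear_simps)
  then have Pnonneg: "P t (\<phi> t) w \<ge> 0" using top[OF t, of w] by (simp add: M_apply)
  define N' where "N' = P' (\<phi> t) (\<phi> t) + 2 * P t (\<phi> t) w"
  define D where "D = (N' - Df t * a' t (\<phi> t) (\<phi> t)) / a t (\<phi> t) (\<phi> t)"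
  have num: "((\<lambda>s. P s (\<psi> t s) (\<psi> t s)) has_real_derivative N') (at t)"
    using bilinear_deriv_at_eigenvector[OF t DP w] by (simp add: N'_def Psym ac_simps)
  have den: "((\<lambda>s. a s (\<psi> t s) (\<psi> t s)) has_real_derivative a' t (\<phi> t) (\<phi> t)) (at t)"
    using bilinear_deriv_at_eigenvector[OF t a_deriv[OF t] w] by (simp add: aw aw')
  have "((\<lambda>s. P s (\<psi> t s) (\<psi> t s) / a s (\<psi> t s) (\<psi> t s)) has_real_derivative D) (at t)"
  proof (rule DERIV_cong[OF DERIV_divide[OF num den]])
    have "P t (\<phi> t) (\<phi> t) = Df t * a t (\<phi> t) (\<phi> t)"
      using att by (simp add: Df_def P_def)
    then show "(N' * a t (\<psi> t t) (\<psi> t t) - P t (\<psi> t t) (\<psi> t t) * a' t (\<phi> t) (\<phi> t))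
        / (a t (\<psi> t t) (\<psi> t t) * a t (\<psi> t t) (\<psi> t t)) = D"
      using att by (simp add: D_def \<psi>_same t field_simps)
  qed (use att in \<open>simp add: \<psi>_same t\<close>)
  moreover have "\<forall>\<^sub>F s in nhds t. Df s = P s (\<psi> t s) (\<psi> t s) / a s (\<psi> t s) (\<psi> t s)"
    unfolding eventually_nhds_conv_at
  proof
    show "\<forall>\<^sub>F s in at t. Df s = P s (\<psi> t s) (\<psi> t s) / a s (\<psi> t s) (\<psi> t s)"
      using eventually_I[OF t] \<psi>_tendsto(1)[OF t]
      by eventually_elim (simp add: Df_\<psi> t P_def)
    show "Df t = P t (\<psi> t t) (\<psi> t t) / a t (\<psi> t t) (\<psi> t t)"
      using Df_\<psi>[OF t _ t] att by (simp add: P_def)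
  qed
  ultimately have "(Df has_real_derivative D) (at t)"
    by (rule DERIV_cong_ev[OF refl _ refl, THEN iffD2, rotated])
  moreover have "D * a t (\<phi> t) (\<phi> t) = N' - Df t * a' t (\<phi> t) (\<phi> t)"
    using att by (simp add: D_def)
  then have "b'' (\<phi> t) (\<phi> t) - f t * a'' (\<phi> t) (\<phi> t) - 2 * Df t * a' t (\<phi> t) (\<phi> t)
      \<le> D * a t (\<phi> t) (\<phi> t)"
    using Pnonneg by (simp add: N'_def P'_def blinfun.bilinear_simps)
  ultimately show ?thesis by blast
qed

end

section \<open>Convexity of the reciprocal of the first eigenvalue\<close>

theorem theorem2:
  fixes J :: "'v::{real_inner, complete_space} \<Rightarrow> 'x::{real_inner, complete_space}"
    and \<epsilon>\<^sub>0 :: real and I :: "real set"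
    and A A' A'' :: "real \<Rightarrow> 'v \<Rightarrow> 'v \<Rightarrow> real"
    and B B' B'' :: "real \<Rightarrow> 'x \<Rightarrow> 'x \<Rightarrow> real"
    and lam :: "nat \<Rightarrow> real \<Rightarrow> real" and u :: "nat \<Rightarrow> real \<Rightarrow> 'v"
    and t :: real
  assumes J: "compact_dense_embedding J"
    and V: "infinite_dimensional TYPE('v)"
    and I: "\<epsilon>\<^sub>0 > 0" "I = {-\<epsilon>\<^sub>0<..<\<epsilon>\<^sub>0}"
    and elliptic: "uniformly_elliptic I A" "uniformly_elliptic I B"
    and diff: "twice_differentiable_forms I A A' A''" "twice_differentiable_forms I B B' B''"
    and eigen: "\<And>s. s \<in> I \<Longrightarrow> eigensystem J (A s) (B s) (\<lambda>k. lam k s) (\<lambda>k. u k s)"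
    and simple: "\<And>s. s \<in> I \<Longrightarrow> lam 0 s < lam 1 s"
    and t: "t \<in> I"
    and ineq:
      "let \<mu> = lam 0 t; \<phi> = u 0 t;
           dA = A' t \<phi> \<phi>; ddA = A'' t \<phi> \<phi>;
           dB = B' t (J \<phi>) (J \<phi>); ddB = B'' t (J \<phi>) (J \<phi>)
       in 2 * dA\<^sup>2 + \<mu>\<^sup>2 * ddB \<ge> \<mu> * (ddA + 2 * dA * dB)"
  shows "(\<forall>s\<in>I. (\<lambda>r. 1 / lam 0 r) differentiable at s) \<and>
         deriv (\<lambda>r. 1 / lam 0 r) differentiable at t \<and>
         deriv (deriv (\<lambda>r. 1 / lam 0 r)) t \<ge> 0"
proof -
  have openI: "open I" using I(2) by simp
  obtain Ca \<delta> where \<delta>: "\<delta> > 0"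
    and Abound: "\<And>s v w. s \<in> I \<Longrightarrow> \<bar>A s v w\<bar> \<le> Ca * norm v * norm w"
    and Acoercive: "\<And>s v. s \<in> I \<Longrightarrow> \<delta> * (norm v)\<^sup>2 \<le> A s v v"
    using elliptic(1) unfolding uniformly_elliptic_def by blast
  obtain Cb \<delta>b where \<delta>b: "\<delta>b > 0"
    and Bbound: "\<And>s x y. s \<in> I \<Longrightarrow> \<bar>B s x y\<bar> \<le> Cb * norm x * norm y"
    and Bcoercive: "\<And>s x. s \<in> I \<Longrightarrow> \<delta>b * (norm x)\<^sup>2 \<le> B s x x"
    using elliptic(2) unfolding uniformly_elliptic_def by blast
  have Asym: "A s v w = A s w v" and Bsym: "B s x y = B s y x"
    and A: "bounded_bilinear (A s)" and B: "bounded_bilinear (B s)" if "s \<in> I" for s v w x y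
    using elliptic that Abound[OF that] Bbound[OF that]
      bounded_bilinear_if_bilinear[of "A s" Ca] bounded_bilinear_if_bilinear[of "B s" Cb]
    unfolding uniformly_elliptic_def by blast+
  have Anonneg: "A s v v \<ge> 0" and Bnonneg: "B s x x \<ge> 0" if "s \<in> I" for s v x
    using Acoercive[OF that, of v] \<delta> Bcoercive[OF that, of x] \<delta>b
    by (meson order_trans zero_le_power2 mult_nonneg_nonneg less_imp_le)+
  obtain C' where "\<And>s v w. s \<in> I \<Longrightarrow>
      \<bar>A' s v w\<bar> \<le> C' * norm v * norm w \<and> \<bar>A'' s v w\<bar> \<le> C' * norm v * norm w"
    using diff(1) unfolding twice_differentiable_forms_def by blast
  then have A': "bounded_bilinear (A' s)" and A'': "bounded_bilinear (A'' s)" if "s \<in> I" for s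
    using diff(1) that unfolding twice_differentiable_forms_def
    by (auto intro!: bounded_bilinear_if_bilinear[of _ C'])
  obtain D' where "\<And>s x y. s \<in> I \<Longrightarrow>
      \<bar>B' s x y\<bar> \<le> D' * norm x * norm y \<and> \<bar>B'' s x y\<bar> \<le> D' * norm x * norm y"
    using diff(2) unfolding twice_differentiable_forms_def by blast
  then have B': "bounded_bilinear (B' s)" and B'': "bounded_bilinear (B'' s)" if "s \<in> I" for s
    using diff(2) that unfolding twice_differentiable_forms_def
    by (auto intro!: bounded_bilinear_if_bilinear[of _ D'])
  define L where "L = Blinfun J"
  have L [simp]: "blinfun_apply L = J"
    using J by (simp add: L_def compact_dense_embedding_def bounded_linear_Blinfun_apply)
  have lam_pos: "lam 0 s > 0" if "s \<in> I" for s
    using eigen[OF that] by (simp add: eigensystem_def)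
  have pair: "A s (u k s) v = lam k s * B s (J (u k s)) (J v)" and unit: "B s (J (u k s)) (J (u k s)) = 1"
    if "s \<in> I" for s k v
    using eigen[OF that] by (simp_all add: eigensystem_def eigenpair_def)
  define f where "f r = 1 / lam 0 r" for r
  note rayleigh = eigenvalue_le_rayleigh_quotient[OF A Asym Anonneg B Bsym Bnonneg eigen]
  interpret simple_top_eigenvalue I "\<lambda>s. form_op (A s)" "\<lambda>s. pullback L (form_op (B s))"
    "\<lambda>s. form_op (A' s)" "\<lambda>s. pullback L (form_op (B' s))" f "u 0" \<delta>
  proof
    fix s assume s: "s \<in> I"
    show "((\<lambda>s. form_op (A s)) has_vector_derivative form_op (A' s)) (at s)"
      by (rule form_op_derivatives(1)[OF openI elliptic(1) diff(1) s])
    show "((\<lambda>s. pullback L (form_op (B s))) has_vector_derivative pullback L (form_op (B' s))) (at s)"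
      by (rule bounded_linear.has_vector_derivative[OF bounded_linear_pullback
            form_op_derivatives(1)[OF openI elliptic(2) diff(2) s]])
    show "u 0 s \<noteq> 0"
    proof
      assume "u 0 s = 0"
      then have "J (u 0 s) = 0" using blinfun.zero_right[of L] by simp
      then show False
        using unit[OF s, of 0] bounded_bilinear.zero_right[OF B[OF s]] by simp
    qed
    fix v w
    show "form_op (A s) v w = form_op (A s) w v" by (simp add: A s Asym)
    show "pullback L (form_op (B s)) v w = pullback L (form_op (B s)) w v" by (simp add: B s Bsym)
    show "\<delta> * (norm v)\<^sup>2 \<le> form_op (A s) v v" by (simp add: A s Acoercive)
    show "pullback L (form_op (B s)) (u 0 s) v = f s * form_op (A s) (u 0 s) v"
      using lam_pos[OF s] by (simp add: A B s f_def pair)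
    show "pullback L (form_op (B s)) v v \<le> f s * form_op (A s) v v"
      using rayleigh[OF s s s s s s s, of 0 v] lam_pos[OF s] by (simp add: A B s f_def field_simps)
  next
    fix s assume s: "s \<in> I"
    have l1: "lam 1 s > 0" and gap01: "1 / lam 1 s < 1 / lam 0 s"
      using lam_pos[OF s] simple[OF s] by (auto intro!: divide_strict_left_mono)
    (* On the complement b <= a / lam 1, so f * a - b dominates the difference of the
       reciprocals times a, which in turn is coercive with constant \<delta>. *)
    define g where "g = (1 / lam 0 s - 1 / lam 1 s) * \<delta>"
    have "g > 0" using gap01 \<delta> by (simp add: g_def)
    moreover have "g * (norm v)\<^sup>2 \<le> f s * form_op (A s) v v - pullback L (form_op (B s)) v v"
      if orth: "form_op (A s) (u 0 s) v = 0" for v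
    proof -
      have "B s (J v) (J (u 0 s)) = 0"
        using orth lam_pos[OF s] pair[OF s, of 0 v] Bsym[OF s] by (simp add: A s)
      then have "B s (J v) (J v) \<le> A s v v / lam 1 s"
        using rayleigh[OF s s s s s s s, of 1 v] l1 by (simp add: field_simps)
      moreover have "g * (norm v)\<^sup>2 \<le> (1 / lam 0 s - 1 / lam 1 s) * A s v v"
        unfolding g_def mult.assoc using gap01 by (intro mult_left_mono Acoercive s) simp
      ultimately show ?thesis by (simp add: A B s f_def algebra_simps)
    qed
    ultimately show "\<exists>g>0. \<forall>v. form_op (A s) (u 0 s) v = 0 \<longrightarrow>
        g * (norm v)\<^sup>2 \<le> f s * form_op (A s) v v - pullback L (form_op (B s)) v v"
      by blast
  qed (use openI \<delta> in auto)
  define \<mu> \<phi> where "\<mu> = lam 0 t" and "\<phi> = u 0 t"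
  define dA ddA dB ddB where "dA = A' t \<phi> \<phi>" and "ddA = A'' t \<phi> \<phi>"
    and "dB = B' t (J \<phi>) (J \<phi>)" and "ddB = B'' t (J \<phi>) (J \<phi>)"
  note defs = \<mu>_def \<phi>_def dA_def ddA_def dB_def ddB_def
  have \<mu>: "\<mu> > 0" using lam_pos[OF t] by (simp add: \<mu>_def)
  have A\<phi>: "A t \<phi> \<phi> = \<mu>"
    using pair[OF t, of 0 \<phi>] unit[OF t, of 0] by (simp add: \<phi>_def \<mu>_def)
  have Df_t: "Df t = (dB - dA / \<mu>) / \<mu>"
    using A\<phi> by (simp add: Df_def A A' B' t f_def blinfun.bilinear_simps defs)
  obtain D where D: "(Df has_real_derivative D) (at t)"
    and "form_op (B'' t) (J \<phi>) (J \<phi>) - f t * form_op (A'' t) \<phi> \<phi> - 2 * Df t * form_op (A' t) \<phi> \<phi>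
      \<le> D * form_op (A t) \<phi> \<phi>"
    using eigenvalue_second_deriv[OF t form_op_derivatives(2)[OF openI elliptic(1) diff(1) t]
        bounded_linear.has_vector_derivative[OF bounded_linear_pullback
          form_op_derivatives(2)[OF openI elliptic(2) diff(2) t]]]
    by (auto simp: \<phi>_def)
  then have "ddB - ddA / \<mu> - 2 * ((dB - dA / \<mu>) / \<mu>) * dA \<le> D * \<mu>"
    by (simp add: A A' A'' B'' t A\<phi> f_def Df_t defs(1,3-6)[symmetric])
  moreover have "ddB - ddA / \<mu> - 2 * ((dB - dA / \<mu>) / \<mu>) * dA
      = (2 * dA\<^sup>2 + \<mu>\<^sup>2 * ddB - \<mu> * (ddA + 2 * dA * dB)) / \<mu>\<^sup>2"
    using \<mu> by (simp add: field_simps power2_eq_square)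
  moreover have "2 * dA\<^sup>2 + \<mu>\<^sup>2 * ddB \<ge> \<mu> * (ddA + 2 * dA * dB)"
    using ineq by (simp add: Let_def defs)
  ultimately have "D * \<mu> \<ge> 0" by (smt (verit) divide_nonneg_nonneg zero_le_power2)
  then have "D \<ge> 0" using \<mu> by (simp add: zero_le_mult_iff)
  have f_deriv: "deriv f s = Df s" if "s \<in> I" for s
    by (rule DERIV_imp_deriv[OF eigenvalue_deriv[OF that]])
  have "(deriv f has_real_derivative D) (at t)"
    by (rule has_field_derivative_transform_within_open[OF D openI t]) (simp add: f_deriv)
  moreover have "f = (\<lambda>r. 1 / lam 0 r)" by (rule ext) (simp add: f_def)
  ultimately show ?thesis
    using \<open>D \<ge> 0\<close> eigenvalue_deriv DERIV_imp_deriv[of "deriv f" D t]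
    by (metis real_differentiable_def)
qed

end
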